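(* Let $G^{\mathscr{A}}$ be a simple connected vertex-labelled graph of order $k$ with adjacency matrix $\mathscr{A}$ and vertex labels $\{1,\dots,k\}$. Let $m_1,\dots,m_k\ge 1$ be integers, and let $G^{\mathscr{A}}_{m_1,\dots,m_k}$ be the $G^{\mathscr{A}}$-complete multipartitioned graph of order $m=m_1+\dots+m_k$. Put $\mathscr{M}=\operatorname{diag}(m_1,\dots,m_k)$. Then: i) the spectrum of (the adjacency matrix of) $G^{\mathscr{A}}_{m_1,\dots,m_k}$ consists, counting multiplicities, of the zero eigenvalue with multiplicity $m-k$ together with all eigenvalues of the $k\times k$ matrix $\mathscr{M}^{1/2}\mathscr{A}\mathscr{M}^{1/2}$; ii) the Moore-Penrose inverse matrix $(\mathscr{M}^{1/2}\mathscr{A}\mathscr{M}^{1/2})^\dagger$ is positively (respectively negatively) signable if and only if the graph $G^{\mathscr{A}}_{m_1,\dots,m_k}$ is positively (respectively negatively) pseudo-invertible; iii) if the adjacency matrix $\mathscr{A}$ is invertible, then the graph $G^{\mathscr{A}}$ is positively (respectively negatively) invertible if and only if the graph $G^{\mathscr{A}}_{m_1,\dots,m_k}$ is positively (respectively negatively) pseudo-invertible.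
   Context: The $G^{\mathscr{A}}$-complete multipartitioned graph $G^{\mathscr{A}}_{m_1,\dots,m_k}$ is constructed from $G^{\mathscr{A}}$ as follows: each vertex $i$ of $G^{\mathscr{A}}$ is replaced by a set $V_i$ of $m_i$ vertices (the $V_i$ being disjoint), and each vertex of $V_i$ is connected to every vertex of $V_j$ precisely when there is an edge between $i$ and $j$ in $G^{\mathscr{A}}$, i.e. $\mathscr{A}_{ij}=1$ (there are no other edges). For a real symmetric matrix $A$, $A^\dagger$ denotes its Moore-Penrose inverse. $A^\dagger$ is called positively (negatively) signable if there exists a diagonal matrix $D$ with diagonal entries in $\{+1,-1\}$ such that all entries of $DA^\dagger D$ are non-negative (non-positive). A graph with adjacency matrix $A$ is called positively (negatively) pseudo-invertible if $A^\dagger$ is positively (negatively) signable; when $A$ is invertible (so $A^\dagger=A^{-1}$) such a graph is called positively (negatively) invertible. *)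

theory Defs
  imports
    "Graph_Theory.Graph_Theory"
    "Jordan_Normal_Form.Char_Poly"
begin

text \<open>
  Simple graphs are rendered as in \<^theory>\<open>Graph_Theory.Pair_Digraph\<close>: an undirected edge is a pair
  of opposite arcs, and the locale \<^locale>\<open>pair_graph\<close> says that the graph is finite, symmetric
  and loop-free.  Rows and columns of the adjacency matrix are indexed from \<open>0\<close> and follow the
  increasing order of the vertices.  For the vertex set \<open>{1..k}\<close>, vertex \<open>i\<close> therefore has index
  \<open>i - 1\<close>.
\<close>

definition adjacency_matrix :: "'a::linorder pair_pre_digraph \<Rightarrow> real mat" where
  "adjacency_matrix G =
    (let vs = sorted_list_of_set (pverts G) in
     mat (length vs) (length vs) (\<lambda>(p, q). if (vs ! p, vs ! q) \<in> parcs G then 1 else 0))"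

definition complete_multipartitioned ::
    "'a pair_pre_digraph \<Rightarrow> ('a \<Rightarrow> 'b set) \<Rightarrow> 'b pair_pre_digraph" where
  "complete_multipartitioned G V =
    \<lparr> pverts = (\<Union>i \<in> pverts G. V i),
      parcs = {(u, v). \<exists>(i, j) \<in> parcs G. u \<in> V i \<and> v \<in> V j} \<rparr>"

text \<open>
  All eigenvalues with their algebraic multiplicities.  The roots are taken over the complex
  numbers, so no eigenvalue of the real matrix is lost.
\<close>

definition spectrum_mset :: "real mat \<Rightarrow> complex multiset" where
  "spectrum_mset A = proots (char_poly (map_mat complex_of_real A))"

definition is_moore_penrose_inverse :: "real mat \<Rightarrow> real mat \<Rightarrow> bool" where
  "is_moore_penrose_inverse A X \<longleftrightarrow>
    X \<in> carrier_mat (dim_col A) (dim_row A) \<and>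
    A * X * A = A \<and>
    X * A * X = X \<and>
    (A * X)\<^sup>T = A * X \<and>
    (X * A)\<^sup>T = X * A"

definition moore_penrose_inverse :: "real mat \<Rightarrow> real mat" where
  "moore_penrose_inverse A = (THE X. is_moore_penrose_inverse A X)"

definition signature_mat :: "nat \<Rightarrow> real mat \<Rightarrow> bool" where
  "signature_mat n D \<longleftrightarrow>
    D \<in> carrier_mat n n \<and> diagonal_mat D \<and> (\<forall>i < n. D $$ (i, i) \<in> {1, -1})"

definition positively_signable :: "real mat \<Rightarrow> bool" where
  "positively_signable B \<longleftrightarrow>
    (\<exists>D. signature_mat (dim_row B) D \<and>
      (\<forall>i < dim_row B. \<forall>j < dim_col B. (D * B * D) $$ (i, j) \<ge> 0))"

definition negatively_signable :: "real mat \<Rightarrow> bool" where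
  "negatively_signable B \<longleftrightarrow>
    (\<exists>D. signature_mat (dim_row B) D \<and>
      (\<forall>i < dim_row B. \<forall>j < dim_col B. (D * B * D) $$ (i, j) \<le> 0))"

definition positively_pseudo_invertible :: "'a::linorder pair_pre_digraph \<Rightarrow> bool" where
  "positively_pseudo_invertible G \<longleftrightarrow>
    positively_signable (moore_penrose_inverse (adjacency_matrix G))"

definition negatively_pseudo_invertible :: "'a::linorder pair_pre_digraph \<Rightarrow> bool" where
  "negatively_pseudo_invertible G \<longleftrightarrow>
    negatively_signable (moore_penrose_inverse (adjacency_matrix G))"

definition positively_invertible :: "'a::linorder pair_pre_digraph \<Rightarrow> bool" where
  "positively_invertible G \<longleftrightarrow>
    invertible_mat (adjacency_matrix G) \<and> positively_pseudo_invertible G"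

definition negatively_invertible :: "'a::linorder pair_pre_digraph \<Rightarrow> bool" where
  "negatively_invertible G \<longleftrightarrow>
    invertible_mat (adjacency_matrix G) \<and> negatively_pseudo_invertible G"

text \<open>The square root of a diagonal matrix with non-negative diagonal entries.\<close>

definition diag_mat_sqrt :: "real mat \<Rightarrow> real mat" where
  "diag_mat_sqrt M = mat_diag (dim_row M) (\<lambda>i. sqrt (M $$ (i, i)))"

end

theory Submission
  imports Defs
begin

text \<open>
  Let \<open>S\<close> be the square root of \<open>M\<close> and \<open>N = S A S\<close>.  Let \<open>n\<close> be the number of vertices of the
  blown-up graph \<open>H\<close>, and let \<open>U\<close> be the \<open>n \<times> k\<close> matrix whose column \<open>a\<close> is the indicator vector of
  the \<open>a\<close>-th vertex class, divided by the square root of the class size.  The classes are disjoint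
  and non-empty, so these columns are orthonormal: \<open>U\<^sup>T U = 1\<close>.  The rows of \<open>U S\<close> are unit vectors
  that select classes.  Every entry of the adjacency matrix \<open>B\<close> of \<open>H\<close> is the entry of \<open>A\<close> at the two
  classes involved, which says exactly that \<open>B = (U S) A (U S)\<^sup>T = U N U\<^sup>T\<close>.  Everything follows from
  this factorisation.

  Spectrum: \<open>P Q\<close> and \<open>Q P\<close> have the same characteristic polynomial up to a power of the variable
  (\<open>char_poly_mult_commute\<close>).  With \<open>P = U N\<close> and \<open>Q = U\<^sup>T\<close> the two products are \<open>B\<close> and \<open>N\<close>.

  Signability: conjugation by an isometry commutes with the Moore-Penrose inverse
  (\<open>moore_penrose_isometric_conjugate\<close>), so the pseudo-inverse of \<open>B\<close> is \<open>U X U\<^sup>T\<close>, where \<open>X\<close> is that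
  of \<open>N\<close>.  Its entry at \<open>(p, q)\<close> is a positive multiple of the entry of \<open>X\<close> at the classes of \<open>p\<close>
  and \<open>q\<close>.  A signature of the classes can be pulled back to the vertices, and a signature of the
  vertices can be restricted to one representative of each class; neither operation disturbs the
  sign condition (\<open>signable_weighted_pullback\<close>).

  Invertible case: if \<open>A\<close> is invertible then \<open>X\<close> is the inverse of \<open>S A S\<close>, a rescaling of the
  inverse of \<open>A\<close> by positive weights, and the same signability lemma applies with one vertex in
  every class.

  The pseudo-inverse is a definite description, so its existence and uniqueness are needed.
  Existence for a symmetric \<open>N\<close> comes from the orthogonal projection \<open>E\<close> onto its kernel: \<open>N + E\<close> is
  invertible, and \<open>(N + E)\<^sup>-\<^sup>1 - E\<close> is the pseudo-inverse.
\<close>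

section \<open>Characteristic polynomials of products\<close>

text \<open>
  As a rewrite rule this form, with dimensions instead of carrier premises, lets the simplifier
  discharge the side conditions of associativity; both directions are used that way.
\<close>
lemma mult_mat_assoc_dim:
  "dim_col A = dim_row B \<Longrightarrow> dim_col B = dim_row C \<Longrightarrow> A * B * C = A * (B * C)"
  for A B C :: "'a::semiring_0 mat"
  by (metis assoc_mult_mat carrier_matI)

lemma index_mult_mat_sum:
  "A \<in> carrier_mat n k \<Longrightarrow> B \<in> carrier_mat k r \<Longrightarrow> i < n \<Longrightarrow> j < r \<Longrightarrow>
    (A * B) $$ (i, j) = (\<Sum>l<k. A $$ (i, l) * B $$ (l, j))"
  by (auto simp: scalar_prod_def lessThan_atLeast0 intro!: sum.cong)

lemma char_poly_lower_block:
  fixes A1 :: "'a::idom mat"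
  assumes A1: "A1 \<in> carrier_mat n n" and A3: "A3 \<in> carrier_mat k n" and A4: "A4 \<in> carrier_mat k k"
  shows "char_poly (four_block_mat A1 (0\<^sub>m n k) A3 A4) = char_poly A1 * char_poly A4"
proof -
  let ?cm = "\<lambda>A. [:0, 1:] \<cdot>\<^sub>m 1\<^sub>m (dim_row A) + map_mat (\<lambda>a. [:- a:]) A"
  have "?cm (four_block_mat A1 (0\<^sub>m n k) A3 A4)
      = four_block_mat (?cm A1) (0\<^sub>m n k) (map_mat (\<lambda>a. [:- a:]) A3) (?cm A4)"
    by (rule eq_matI, insert assms, auto simp: one_poly_def)
  moreover have "det (four_block_mat (?cm A1) (0\<^sub>m n k) (map_mat (\<lambda>a. [:- a:]) A3) (?cm A4))
      = det (?cm A1) * det (?cm A4)"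
    by (rule det_four_block_mat_upper_right_zero) (use assms in auto)
  ultimately show ?thesis
    unfolding char_poly_defs using A1 A4 by simp
qed

lemma char_poly_zero_mat:
  "char_poly (0\<^sub>m n n :: 'a::comm_ring_1 mat) = monom 1 n"
proof -
  have "char_poly (0\<^sub>m n n :: 'a mat) = (\<Prod>a \<leftarrow> diag_mat (0\<^sub>m n n :: 'a mat). [:- a, 1:])"
    by (rule char_poly_upper_triangular[of _ n]) (auto simp: upper_triangular_def)
  also have "diag_mat (0\<^sub>m n n :: 'a mat) = replicate n 0"
    by (rule nth_equalityI) (auto simp: diag_mat_def)
  finally show ?thesis by (simp add: monom_altdef)
qed

text \<open>
  Conjugating the block matrix with rows \<open>X Y, 0\<close> and \<open>Y, 0\<close> by the shear with upper right block \<open>X\<close>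
  moves the product to the other corner: the result has rows \<open>0, 0\<close> and \<open>Y, Y X\<close>.  Both matrices
  are block triangular, so their characteristic polynomials factor.
\<close>
lemma char_poly_mult_commute:
  fixes X Y :: "'a::idom mat"
  assumes X: "X \<in> carrier_mat n k" and Y: "Y \<in> carrier_mat k n"
  shows "char_poly (X * Y) * monom 1 k = monom 1 n * char_poly (Y * X)"
proof -
  let ?L = "four_block_mat (X * Y) (0\<^sub>m n k) Y (0\<^sub>m k k)"
  let ?R = "four_block_mat (0\<^sub>m n n) (0\<^sub>m n k) Y (Y * X)"
  let ?P = "four_block_mat (1\<^sub>m n) X (0\<^sub>m k n) (1\<^sub>m k)"
  let ?Q = "four_block_mat (1\<^sub>m n) (- X) (0\<^sub>m k n) (1\<^sub>m k)"
  have XY: "X * Y \<in> carrier_mat n n" and YX: "Y * X \<in> carrier_mat k k"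
    and XYX: "X * (Y * X) \<in> carrier_mat n k"
    using X Y by auto
  have cancel: "- Z + Z = 0\<^sub>m r s" "Z + - Z = 0\<^sub>m r s" if "Z \<in> carrier_mat r s" for Z :: "'a mat" and r s
    using that by auto
  have neg_zero: "- (0\<^sub>m k k :: 'a mat) = 0\<^sub>m k k"
    by (rule eq_matI) auto
  have PQ: "?P * ?Q = 1\<^sub>m (n + k)"
    by (subst mult_four_block_mat[of _ n n _ k _ k _ _ n _ k]) (use X in \<open>auto simp: cancel neg_zero\<close>)
  have QP: "?Q * ?P = 1\<^sub>m (n + k)"
    by (subst mult_four_block_mat[of _ n n _ k _ k _ _ n _ k])
      (use X in \<open>auto simp: cancel neg_zero\<close>)
  have PR: "?P * ?R = four_block_mat (X * Y) (X * (Y * X)) Y (Y * X)"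
    by (subst mult_four_block_mat[of _ n n _ k _ k _ _ n _ k]) (use X Y in auto)
  have "?P * ?R * ?Q = ?L"
    unfolding PR
    by (subst mult_four_block_mat[of _ n n _ k _ k _ _ n _ k])
      (use X Y XY YX XYX in \<open>auto simp: cancel mult_mat_assoc_dim\<close>)
  then have "similar_mat ?L ?R"
    using PQ QP X Y by (intro similar_matI[of _ _ ?P ?Q "n + k"]) auto
  then have "char_poly ?L = char_poly ?R"
    by (rule char_poly_similar)
  then show ?thesis
    using X Y by (simp add: char_poly_lower_block[OF XY Y] char_poly_lower_block[OF _ Y YX]
        char_poly_zero_mat)
qed

text \<open>
  Apply \<open>char_poly_mult_commute\<close> to \<open>U N\<close> and \<open>U\<^sup>T\<close>, whose product in the other order is \<open>U\<^sup>T U N = N\<close>.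
\<close>
lemma spectrum_mset_isometric_conjugate:
  assumes U: "U \<in> carrier_mat n k" and N: "N \<in> carrier_mat k k"
    and UU: "U\<^sup>T * U = 1\<^sub>m k" and "k \<le> n"
  shows "spectrum_mset (U * N * U\<^sup>T) = replicate_mset (n - k) 0 + spectrum_mset N"
proof -
  let ?h = "map_mat complex_of_real"
  have YX: "U\<^sup>T * (U * N) = N"
    using U N UU by (simp del: assoc_mult_mat flip: mult_mat_assoc_dim)
  have "?h (U * N * U\<^sup>T) = ?h (U * N) * ?h (U\<^sup>T)"
    by (rule of_real_hom.mat_hom_mult) (use U N in auto)
  moreover have "?h (U\<^sup>T) * ?h (U * N) = ?h N"
    by (subst of_real_hom.mat_hom_mult[symmetric]) (use U N YX in auto)
  ultimately have eq: "char_poly (?h (U * N * U\<^sup>T)) * monom 1 k = monom 1 n * char_poly (?h N)"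
    using char_poly_mult_commute[of "?h (U * N)" n k "?h (U\<^sup>T)"] U N by simp
  have nz: "char_poly (?h C) \<noteq> 0" if "C \<in> carrier_mat r r" for C r
    using degree_monic_char_poly[of "?h C" r] that by (metis coeff_0 map_carrier_mat zero_neq_one)
  have [simp]: "proots (monom 1 j :: complex poly) = replicate_mset j 0" for j
    by (simp add: monom_altdef proots_power)
  have "spectrum_mset (U * N * U\<^sup>T) + replicate_mset k 0 = replicate_mset n 0 + spectrum_mset N"
    using arg_cong[OF eq, of proots] nz[of "U * N * U\<^sup>T" n] nz[OF N] U N
    by (simp add: spectrum_mset_def proots_mult)
  moreover have "replicate_mset n (0::complex) = replicate_mset (n - k) 0 + replicate_mset k 0"
    using \<open>k \<le> n\<close> by (intro multiset_eqI) simp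
  ultimately show ?thesis by simp
qed

section \<open>The Moore-Penrose inverse of a symmetric matrix\<close>

text \<open>
  The products \<open>A X\<close> and \<open>A Y\<close> absorb each other, \<open>A Y A X = A X\<close> and \<open>A X A Y = A Y\<close>.  As all of them
  are symmetric, transposing one identity gives \<open>A X = A Y\<close>.  Likewise \<open>X A = Y A\<close>, and then
  \<open>X = X A X = X A Y = Y A Y = Y\<close>.
\<close>
lemma is_moore_penrose_inverse_unique:
  assumes X: "is_moore_penrose_inverse A X" and Y: "is_moore_penrose_inverse A Y"
  shows "X = Y"
proof -
  let ?n = "dim_row A" and ?k = "dim_col A"
  have dims [simp]: "dim_row X = ?k" "dim_col X = ?n" "dim_row Y = ?k" "dim_col Y = ?n"
    using assms by (auto simp: is_moore_penrose_inverse_def)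
  have AX: "A * X * A = A" "X * A * X = X" "(A * X)\<^sup>T = A * X" "(X * A)\<^sup>T = X * A"
    using X by (auto simp: is_moore_penrose_inverse_def)
  have AY: "A * Y * A = A" "Y * A * Y = Y" "(A * Y)\<^sup>T = A * Y" "(Y * A)\<^sup>T = Y * A"
    using Y by (auto simp: is_moore_penrose_inverse_def)
  have "A * X = (A * Y) * (A * X)"
    using AY(1) by (metis dims index_mult_mat(2,3) mult_mat_assoc_dim)
  then have "A * X = ((A * X) * (A * Y))\<^sup>T"
    using AX(3) AY(3) transpose_mult[of "A * X" ?n ?n "A * Y" ?n]
    by (metis carrier_matI dims index_mult_mat(2,3))
  also have "(A * X) * (A * Y) = A * Y"
    using AX(1) by (metis dims index_mult_mat(2,3) mult_mat_assoc_dim)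
  finally have right: "A * X = A * Y" using AY(3) by simp
  have "X * A = (X * A) * (Y * A)"
    using AY(1) by (metis dims index_mult_mat(2,3) mult_mat_assoc_dim)
  then have "X * A = ((Y * A) * (X * A))\<^sup>T"
    using AX(4) AY(4) transpose_mult[of "Y * A" ?k ?k "X * A" ?k]
    by (metis carrier_matI dims index_mult_mat(2,3))
  also have "(Y * A) * (X * A) = Y * A"
    using AX(1) by (metis dims index_mult_mat(2,3) mult_mat_assoc_dim)
  finally have left: "X * A = Y * A" using AY(4) by simp
  have "X = X * (A * X)" using AX(2) by (simp add: mult_mat_assoc_dim)
  also have "\<dots> = Y * A * Y" by (simp add: right left del: assoc_mult_mat flip: mult_mat_assoc_dim)
  finally show ?thesis using AY(2) by simp
qed

lemma moore_penrose_inverse_eqI: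
  "is_moore_penrose_inverse A X \<Longrightarrow> moore_penrose_inverse A = X"
  unfolding moore_penrose_inverse_def
  by (rule the_equality) (auto intro: is_moore_penrose_inverse_unique)

text \<open>
  The orthogonal projection \<open>v v\<^sup>T / (v \<bullet> v)\<close> onto the line of \<open>v\<close>; the trace measures its rank.
\<close>
lemma rank_one_projection:
  fixes v :: "real vec"
  assumes v: "v \<in> carrier_vec n" "v \<noteq> 0\<^sub>v n"
  obtains W where "W \<in> carrier_mat n n" "W\<^sup>T = W" "W * W = W" "(\<Sum>i<n. W $$ (i, i)) = 1"
    and "\<And>A. A \<in> carrier_mat n n \<Longrightarrow> A *\<^sub>v v = 0\<^sub>v n \<Longrightarrow> A * W = 0\<^sub>m n n"
proof -
  define s where "s = (\<Sum>i<n. v $ i * v $ i)"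
  obtain i where i: "i < n" "v $ i \<noteq> 0"
    using v by (metis carrier_vecD eq_vecI index_zero_vec)
  have "0 < s"
    unfolding s_def by (rule sum_pos2[of _ i]) (use i in \<open>auto simp: zero_less_mult_iff\<close>)
  let ?W = "mat n n (\<lambda>(i, j). v $ i * v $ j / s)"
  show thesis
  proof (rule that[of ?W])
    show "?W * ?W = ?W"
    proof (rule eq_matI)
      fix i j assume ij: "i < dim_row ?W" "j < dim_col ?W"
      then have "(?W * ?W) $$ (i, j) = (\<Sum>l<n. (v $ i * v $ j / s / s) * (v $ l * v $ l))"
        by (auto simp: scalar_prod_def lessThan_atLeast0 intro!: sum.cong)
      also have "\<dots> = v $ i * v $ j / s"
        using \<open>0 < s\<close> unfolding sum_distrib_left[symmetric] s_def[symmetric] by simp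
      finally show "(?W * ?W) $$ (i, j) = ?W $$ (i, j)" using ij by simp
    qed auto
    show "(\<Sum>i<n. ?W $$ (i, i)) = 1"
      using \<open>0 < s\<close> by (simp add: s_def flip: sum_divide_distrib)
    show "?W\<^sup>T = ?W" by (rule eq_matI) (auto simp: mult.commute)
    fix A :: "real mat" assume A: "A \<in> carrier_mat n n" and Av: "A *\<^sub>v v = 0\<^sub>v n"
    show "A * ?W = 0\<^sub>m n n"
    proof (rule eq_matI)
      fix i j assume ij: "i < dim_row (0\<^sub>m n n :: real mat)" "j < dim_col (0\<^sub>m n n :: real mat)"
      have "(A * ?W) $$ (i, j) = (\<Sum>l<n. A $$ (i, l) * v $ l) * (v $ j / s)"
        using ij A unfolding sum_distrib_right
        by (auto simp: scalar_prod_def lessThan_atLeast0 intro!: sum.cong)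
      also have "(\<Sum>l<n. A $$ (i, l) * v $ l) = (A *\<^sub>v v) $ i"
        using ij A v by (auto simp: scalar_prod_def lessThan_atLeast0 intro!: sum.cong)
      finally show "(A * ?W) $$ (i, j) = 0\<^sub>m n n $$ (i, j)" using ij Av by simp
    qed (use A in auto)
  qed auto
qed

text \<open>
  Each diagonal entry \<open>x\<close> of a projection is the squared norm of its row, hence \<open>x \<ge> x\<^sup>2\<close> and \<open>x \<le> 1\<close>.
\<close>
lemma trace_projection_le:
  fixes E :: "real mat"
  assumes E: "E \<in> carrier_mat n n" "E\<^sup>T = E" "E * E = E"
  shows "(\<Sum>i<n. E $$ (i, i)) \<le> real n"
proof -
  have "E $$ (i, i) \<le> 1" if i: "i < n" for i
  proof -
    have sym: "E $$ (l, i) = E $$ (i, l)" if "l < n" for l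
      using E i that by (metis carrier_matD index_transpose_mat(1))
    have "E $$ (i, i) = (E * E) $$ (i, i)" using E by simp
    also have "\<dots> = (\<Sum>l<n. (E $$ (i, l))\<^sup>2)"
      using E(1) i sym by (simp add: index_mult_mat_sum[of _ n n _ n] power2_eq_square del: index_mult_mat)
    also have "\<dots> \<ge> (E $$ (i, i))\<^sup>2"
      by (rule member_le_sum) (use i in auto)
    finally have "(E $$ (i, i))\<^sup>2 \<le> E $$ (i, i) * 1" by simp
    then show ?thesis
      using mult_strict_left_mono[of 1 "E $$ (i, i)" "E $$ (i, i)"]
      by (cases "E $$ (i, i) \<le> 1") (auto simp: power2_eq_square)
  qed
  then have "(\<Sum>i<n. E $$ (i, i)) \<le> (\<Sum>i<n. 1)"
    by (intro sum_mono) auto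
  then show ?thesis by simp
qed

text \<open>
  The projection \<open>E\<close> onto the kernel of \<open>N\<close> is found by enlarging a projection onto part of the
  kernel until \<open>N + E\<close> is non-singular.  As long as \<open>(N + E) v = 0\<close> for some \<open>v \<noteq> 0\<close>, multiplying by
  \<open>E\<close> shows \<open>E v = 0\<close> and then \<open>N v = 0\<close>, so \<open>v\<close> is a new kernel direction and adding the projection
  onto it raises the trace by \<open>1\<close>.  The trace of a projection is at most \<open>n\<close>, so this stops.
\<close>
lemma symmetric_kernel_projection:
  fixes N :: "real mat"
  assumes N: "N \<in> carrier_mat n n" "N\<^sup>T = N"
  obtains E where "E \<in> carrier_mat n n" "E\<^sup>T = E" "E * E = E" "N * E = 0\<^sub>m n n" "det (N + E) \<noteq> 0"
proof (rule ccontr)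
  let ?proj = "\<lambda>E. E \<in> carrier_mat n n \<and> E\<^sup>T = E \<and> E * E = E \<and> N * E = 0\<^sub>m n n"
  assume "\<not> thesis"
  with that have singular: "det (N + E) = 0" if "?proj E" for E
    using that by blast
  \<comment> \<open>If \<open>N + E\<close> were always singular, the trace could be raised to every natural number.\<close>
  have "\<exists>E. ?proj E \<and> (\<Sum>i<n. E $$ (i, i)) = real t" for t
  proof (induction t)
    case 0
    show ?case using N by (intro exI[of _ "0\<^sub>m n n"]) auto
  next
    case (Suc t)
    then obtain E where E: "E \<in> carrier_mat n n" "E\<^sup>T = E" "E * E = E" "N * E = 0\<^sub>m n n"
      and tr: "(\<Sum>i<n. E $$ (i, i)) = real t" by auto
    have "E * N = (N * E)\<^sup>T" using transpose_mult[OF N(1) E(1)] N(2) E(2) by simp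
    then have EN: "E * N = 0\<^sub>m n n" using E(4) by simp
    from singular E have "det (N + E) = 0" by blast
    then obtain v where v: "v \<in> carrier_vec n" "v \<noteq> 0\<^sub>v n" and NEv: "(N + E) *\<^sub>v v = 0\<^sub>v n"
      using det_0_iff_vec_prod_zero_field[of "N + E" n] N E by auto
    \<comment> \<open>\<open>E (N + E) = E\<close>, because \<open>E N = 0\<close> and \<open>E E = E\<close>\<close>
    have "E *\<^sub>v v = (E * (N + E)) *\<^sub>v v"
      using E N EN by (subst mult_add_distrib_mat[of _ n n _ n]) auto
    also have "\<dots> = 0\<^sub>v n"
      using E N v NEv by (subst assoc_mult_mat_vec[of _ n n _ n]) auto
    finally have Ev: "E *\<^sub>v v = 0\<^sub>v n" .
    have Nv: "N *\<^sub>v v = 0\<^sub>v n"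
      using NEv Ev add_mult_distrib_mat_vec[OF N(1) E(1) v(1)] N v by simp
    obtain W where W: "W \<in> carrier_mat n n" "W\<^sup>T = W" "W * W = W"
      and trW: "(\<Sum>i<n. W $$ (i, i)) = 1"
      and kill: "\<And>A. A \<in> carrier_mat n n \<Longrightarrow> A *\<^sub>v v = 0\<^sub>v n \<Longrightarrow> A * W = 0\<^sub>m n n"
      using rank_one_projection[OF v] by blast
    have EW: "E * W = 0\<^sub>m n n" and NW: "N * W = 0\<^sub>m n n"
      using kill E(1) Ev N(1) Nv by auto
    have "W * E = (E * W)\<^sup>T" using transpose_mult[OF E(1) W(1)] E(2) W(2) by simp
    then have WE: "W * E = 0\<^sub>m n n" using EW by simp
    have "?proj (E + W)"
      using E W EW WE NW N transpose_add[OF E(1) W(1)]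
      by (simp add: add_mult_distrib_mat[of _ n n _ _ n] mult_add_distrib_mat[of _ n n _ n])
    moreover have "(\<Sum>i<n. (E + W) $$ (i, i)) = real (Suc t)"
      using E W tr trW by (simp add: sum.distrib)
    ultimately show ?case by blast
  qed
  from this[of "Suc n"] obtain E where "?proj E" "(\<Sum>i<n. E $$ (i, i)) = real (Suc n)" by blast
  then show False using trace_projection_le[of E n] by simp
qed

text \<open>
  Since \<open>E\<close> annihilates \<open>N\<close>, the inverse \<open>Z\<close> of \<open>N + E\<close> fixes \<open>E\<close>, so \<open>Z - E\<close> inverts \<open>N\<close> on the range of
  \<open>N\<close> and vanishes on its kernel: both products with \<open>N\<close> equal \<open>1 - E\<close>.
\<close>
lemma symmetric_moore_penrose_exists:
  assumes N: "N \<in> carrier_mat n n" "N\<^sup>T = N"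
  shows "\<exists>X. is_moore_penrose_inverse N X"
proof -
  obtain E where E: "E \<in> carrier_mat n n" "E\<^sup>T = E" "E * E = E" "N * E = 0\<^sub>m n n" "det (N + E) \<noteq> 0"
    using symmetric_kernel_projection[OF N] .
  have "E * N = (N * E)\<^sup>T" using transpose_mult[OF N(1) E(1)] N(2) E(2) by simp
  then have EN: "E * N = 0\<^sub>m n n" using E(4) by simp
  obtain Z where Z: "Z \<in> carrier_mat n n" and inv: "Z * (N + E) = 1\<^sub>m n" "(N + E) * Z = 1\<^sub>m n"
  proof -
    have "N + E \<in> Units (ring_mat TYPE(real) n ())"
      by (rule det_non_zero_imp_unit) (use N E in auto)
    then show ?thesis
      unfolding Units_def ring_mat_simps by (auto intro: that)
  qed
  note c = N(1) E(1) Z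
  have "(N + E) * E = E" "E * (N + E) = E"
    using c E EN by (simp_all add: add_mult_distrib_mat[of _ n n] mult_add_distrib_mat[of _ n n])
  moreover have "Z * ((N + E) * E) = E" "(E * (N + E)) * Z = E"
    using c inv by (simp del: assoc_mult_mat flip: mult_mat_assoc_dim, simp add: mult_mat_assoc_dim)
  ultimately have ZE: "Z * E = E" and EZ: "E * Z = E"
    by metis+
  have NZ: "N * Z = 1\<^sub>m n - E"
  proof -
    have "N * Z = (N * Z + E * Z) - E" using c EZ by auto
    then show ?thesis using c inv by (simp flip: add_mult_distrib_mat)
  qed
  have ZN: "Z * N = 1\<^sub>m n - E"
  proof -
    have "Z * N = (Z * N + Z * E) - E" using c ZE by auto
    then show ?thesis using c inv by (simp flip: mult_add_distrib_mat)
  qed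
  have NX: "N * (Z - E) = 1\<^sub>m n - E"
    using c E NZ by (auto simp: mult_minus_distrib_mat[of _ n n])
  have XN: "(Z - E) * N = 1\<^sub>m n - E"
    using c EN ZN by (auto simp: minus_mult_distrib_mat[of _ n n])
  have "(1\<^sub>m n - E)\<^sup>T = 1\<^sub>m n - E"
    using E transpose_minus[of "1\<^sub>m n" n n E] by simp
  moreover have "(1\<^sub>m n - E) * N = N"
    using c EN by (auto simp: minus_mult_distrib_mat[of _ n n])
  moreover have "E * (Z - E) = 0\<^sub>m n n"
    using c E(3) EZ by (auto simp: mult_minus_distrib_mat[of _ n n])
  then have "(1\<^sub>m n - E) * (Z - E) = 1\<^sub>m n * (Z - E) - 0\<^sub>m n n"
    using c by (subst minus_mult_distrib_mat[of _ n n _ _ n]) (simp_all add: minus_carrier_mat)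
  then have "(1\<^sub>m n - E) * (Z - E) = Z - E"
    using c by (auto simp: left_mult_one_mat[OF minus_carrier_mat])
  ultimately have "is_moore_penrose_inverse N (Z - E)"
    using c NX XN by (simp add: is_moore_penrose_inverse_def minus_carrier_mat)
  then show ?thesis by blast
qed

text \<open>
  Because \<open>U\<^sup>T U = 1\<close>, the map \<open>P \<mapsto> U P U\<^sup>T\<close> preserves products and transposes, hence all four
  Penrose equations.
\<close>
lemma moore_penrose_isometric_conjugate:
  assumes U: "U \<in> carrier_mat n k" and N: "N \<in> carrier_mat k k"
    and UU: "U\<^sup>T * U = 1\<^sub>m k" and X: "is_moore_penrose_inverse N X"
  shows "is_moore_penrose_inverse (U * N * U\<^sup>T) (U * X * U\<^sup>T)"
proof -
  have Xc: "X \<in> carrier_mat k k"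
    and mp: "N * X * N = N" "X * N * X = X" "(N * X)\<^sup>T = N * X" "(X * N)\<^sup>T = X * N"
    using X N by (auto simp: is_moore_penrose_inverse_def)
  have prod: "(U * P * U\<^sup>T) * (U * Q * U\<^sup>T) = U * (P * Q) * U\<^sup>T"
    if "P \<in> carrier_mat k k" "Q \<in> carrier_mat k k" for P Q
  proof -
    have dims: "dim_row U = n" "dim_col U = k" "dim_row P = k" "dim_col P = k"
      "dim_row Q = k" "dim_col Q = k"
      using U that by auto
    have "U\<^sup>T * (U * (Q * U\<^sup>T)) = (U\<^sup>T * U) * (Q * U\<^sup>T)"
      by (rule mult_mat_assoc_dim[symmetric]) (simp_all add: dims)
    then have "U\<^sup>T * (U * (Q * U\<^sup>T)) = Q * U\<^sup>T"
      using U that(2) by (simp add: UU left_mult_one_mat[OF mult_carrier_mat])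
    then show ?thesis
      by (simp add: mult_mat_assoc_dim dims)
  qed
  have tr: "(U * P * U\<^sup>T)\<^sup>T = U * P\<^sup>T * U\<^sup>T" if "P \<in> carrier_mat k k" for P
    using U that transpose_mult[of "U * P" n k "U\<^sup>T" n] transpose_mult[of U n k P k]
    by (simp add: mult_mat_assoc_dim)
  have "U * X * U\<^sup>T \<in> carrier_mat n n" using U Xc by simp
  then show ?thesis
    unfolding is_moore_penrose_inverse_def
    using U N Xc mp by (simp add: prod tr mult_carrier_mat[of _ k k] del: assoc_mult_mat)
qed

lemma moore_penrose_inverse_of_inverse:
  assumes "A \<in> carrier_mat n n" "B \<in> carrier_mat n n" "A * B = 1\<^sub>m n" "B * A = 1\<^sub>m n"
  shows "moore_penrose_inverse A = B"
  by (rule moore_penrose_inverse_eqI) (use assms in \<open>simp add: is_moore_penrose_inverse_def\<close>)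

section \<open>Weighted incidence matrices of index classes\<close>

text \<open>
  The incidence matrix between \<open>n\<close> indices and the \<open>k\<close> fibres of \<open>c\<close>, with column weights.  Conjugating
  a \<open>k \<times> k\<close> matrix by it copies entry \<open>(a, b)\<close>, scaled by \<open>w a * w b\<close>, to
  all positions whose row lies over \<open>a\<close> and whose column lies over \<open>b\<close>.
\<close>
definition fibre_mat :: "nat \<Rightarrow> nat \<Rightarrow> (nat \<Rightarrow> nat) \<Rightarrow> (nat \<Rightarrow> real) \<Rightarrow> real mat" where
  "fibre_mat n k c w = mat n k (\<lambda>(p, a). if c p = a then w a else 0)"

lemma fibre_mat_carrier [simp]: "fibre_mat n k c w \<in> carrier_mat n k"
  by (simp add: fibre_mat_def)

lemma fibre_mat_dim [simp]: "dim_row (fibre_mat n k c w) = n" "dim_col (fibre_mat n k c w) = k"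
  by (simp_all add: fibre_mat_def)

lemma fibre_mat_index:
  "p < n \<Longrightarrow> a < k \<Longrightarrow> fibre_mat n k c w $$ (p, a) = (if c p = a then w a else 0)"
  by (simp add: fibre_mat_def)

lemma fibre_mat_conjugate_index:
  assumes N: "N \<in> carrier_mat k k" and c: "\<And>p. p < n \<Longrightarrow> c p < k" and pq: "p < n" "q < n"
  shows "(fibre_mat n k c w * N * (fibre_mat n k c w)\<^sup>T) $$ (p, q) = w (c p) * N $$ (c p, c q) * w (c q)"
proof -
  let ?F = "fibre_mat n k c w"
  have left: "(?F * N) $$ (p, b) = w (c p) * N $$ (c p, b)" if "b < k" for b
  proof -
    have "(?F * N) $$ (p, b) = (\<Sum>a<k. if c p = a then w a * N $$ (a, b) else 0)"
      unfolding index_mult_mat_sum[OF fibre_mat_carrier N pq(1) that]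
      by (rule sum.cong) (use pq in \<open>simp_all add: fibre_mat_def\<close>)
    then show ?thesis using c pq by simp
  qed
  have "(?F * N * ?F\<^sup>T) $$ (p, q) = (\<Sum>b<k. (?F * N) $$ (p, b) * ?F $$ (q, b))"
    using mult_carrier_mat[OF fibre_mat_carrier N] pq
    by (subst index_mult_mat_sum[of "?F * N" n k _ n])
      (simp_all add: fibre_mat_index del: index_mult_mat(1))
  also have "\<dots> = (\<Sum>b<k. if c q = b then w (c p) * N $$ (c p, b) * w b else 0)"
    by (rule sum.cong) (use left pq in \<open>simp_all add: fibre_mat_index del: index_mult_mat(1)\<close>)
  finally show ?thesis using c pq by simp
qed

lemma fibre_mat_isometry:
  assumes w: "\<And>a. a < k \<Longrightarrow> (w a)\<^sup>2 * real (card {p \<in> {..<n}. c p = a}) = 1"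
  shows "(fibre_mat n k c w)\<^sup>T * fibre_mat n k c w = 1\<^sub>m k"
proof (rule eq_matI)
  let ?F = "fibre_mat n k c w"
  fix a b assume "a < dim_row (1\<^sub>m k :: real mat)" "b < dim_col (1\<^sub>m k :: real mat)"
  then have ab: "a < k" "b < k" by auto
  then have "(?F\<^sup>T * ?F) $$ (a, b) = (\<Sum>p<n. if c p = a then (if a = b then (w a)\<^sup>2 else 0) else 0)"
    by (subst index_mult_mat_sum[of _ k n _ k])
      (auto simp: fibre_mat_def power2_eq_square intro!: sum.cong sum.neutral)
  also have "\<dots> = (\<Sum>p \<in> {p \<in> {..<n}. c p = a}. if a = b then (w a)\<^sup>2 else 0)"
    by (rule sum.inter_filter[symmetric]) simp
  also have "\<dots> = (1\<^sub>m k :: real mat) $$ (a, b)"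
    using ab w[of a] by (cases "a = b") (simp_all add: mult.commute)
  finally show "(?F\<^sup>T * ?F) $$ (a, b) = (1\<^sub>m k :: real mat) $$ (a, b)" .
qed auto

section \<open>Signability\<close>

text \<open>
  A signature matrix is determined by its diagonal \<open>d\<close>, and conjugation by it is entrywise
  multiplication by \<open>d i * d j\<close>.
\<close>
lemma positively_signable_iff:
  assumes B: "B \<in> carrier_mat n n"
  shows "positively_signable B \<longleftrightarrow>
    (\<exists>d. \<forall>i<n. d i \<in> {1, -1} \<and> (\<forall>j<n. d i * B $$ (i, j) * d j \<ge> 0))" (is "_ = ?rhs")
proof -
  have entry: "(mat_diag n d * B * mat_diag n d) $$ (i, j) = d i * B $$ (i, j) * d j"
    if "i < n" "j < n" for d :: "nat \<Rightarrow> real" and i j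
    using B that by (simp add: mat_diag_mult_left[of _ n n] mat_diag_mult_right[of _ n n])
  show ?thesis
  proof
    assume "positively_signable B"
    then obtain D where D: "signature_mat n D" and ge: "\<forall>i<n. \<forall>j<n. (D * B * D) $$ (i, j) \<ge> 0"
      using B by (auto simp: positively_signable_def)
    have "D = mat_diag n (\<lambda>i. D $$ (i, i))"
      by (rule eq_matI) (use D in \<open>auto simp: signature_mat_def mat_diag_def diagonal_mat_def\<close>)
    then have "D $$ (i, i) * B $$ (i, j) * D $$ (j, j) \<ge> 0" if "i < n" "j < n" for i j
      using ge entry[OF that, of "\<lambda>i. D $$ (i, i)"] that by metis
    then show ?rhs using D by (intro exI[of _ "\<lambda>i. D $$ (i, i)"]) (auto simp: signature_mat_def)
  next
    assume ?rhs
    then obtain d where d: "\<forall>i<n. d i \<in> {1, -1} \<and> (\<forall>j<n. d i * B $$ (i, j) * d j \<ge> 0)" ..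
    then have "signature_mat n (mat_diag n d)"
      by (auto simp: signature_mat_def diagonal_mat_def mat_diag_def)
    then show "positively_signable B"
      using B d entry unfolding positively_signable_def
      by (intro exI[of _ "mat_diag n d"]) (auto simp del: index_mult_mat)
  qed
qed

text \<open>
  Reduces negative signability to positive signability, so that each transfer result needs one proof.
\<close>
lemma negatively_signable_iff_uminus:
  assumes B: "B \<in> carrier_mat n n"
  shows "negatively_signable B \<longleftrightarrow> positively_signable (- B)"
proof -
  have "D * (- B) * D = - (D * B * D)" if "D \<in> carrier_mat n n" for D
    using B that by simp
  then show ?thesis
    using B unfolding negatively_signable_def positively_signable_def
    by (intro ex_cong1 conj_cong refl) (auto simp: signature_mat_def)
qed

text \<open>
  The positive weights do not affect signs.  A signature \<open>d\<close> of the classes yields \<open>d \<circ> c\<close>; conversely,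
  choosing a representative \<open>r a\<close> in every class, which is possible as \<open>c\<close> is onto, turns a signature
  \<open>d\<close> of the indices into \<open>d \<circ> r\<close>.
\<close>
lemma signable_weighted_pullback:
  assumes N: "N \<in> carrier_mat k k" and F: "F \<in> carrier_mat n n"
    and c: "c ` {..<n} = {..<k}" and w: "\<And>a. a < k \<Longrightarrow> w a > 0"
    and entry: "\<And>p q. p < n \<Longrightarrow> q < n \<Longrightarrow> F $$ (p, q) = w (c p) * N $$ (c p, c q) * w (c q)"
  shows "positively_signable F \<longleftrightarrow> positively_signable N" (is ?pos)
    and "negatively_signable F \<longleftrightarrow> negatively_signable N" (is ?neg)
proof -
  have ck: "c p < k" if "p < n" for p using c that by blast
  have pos: "positively_signable F' \<longleftrightarrow> positively_signable N'"
    if N': "N' \<in> carrier_mat k k" and F': "F' \<in> carrier_mat n n"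
      and entry': "\<And>p q. p < n \<Longrightarrow> q < n \<Longrightarrow> F' $$ (p, q) = w (c p) * N' $$ (c p, c q) * w (c q)"
    for F' N'
  proof
    assume "positively_signable F'"
    then obtain d where d: "\<forall>p<n. d p \<in> {1, -1} \<and> (\<forall>q<n. d p * F' $$ (p, q) * d q \<ge> 0)"
      using positively_signable_iff[OF F'] by blast
    have "\<forall>a\<in>{..<k}. \<exists>p. p < n \<and> c p = a" using c by (metis imageE lessThan_iff)
    then obtain r where r: "\<And>a. a < k \<Longrightarrow> r a < n \<and> c (r a) = a" by (metis lessThan_iff)
    have "d (r a) * N' $$ (a, b) * d (r b) \<ge> 0" if "a < k" "b < k" for a b
    proof -
      have "0 \<le> d (r a) * F' $$ (r a, r b) * d (r b)" using d r that by blast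
      also have "\<dots> = (w a * w b) * (d (r a) * N' $$ (a, b) * d (r b))"
        using entry' r that by simp
      finally show ?thesis
        using mult_pos_pos[OF w[OF that(1)] w[OF that(2)]] by (metis zero_le_mult_iff not_le)
    qed
    then show "positively_signable N'"
      unfolding positively_signable_iff[OF N'] using d r by (intro exI[of _ "d \<circ> r"]) auto
  next
    assume "positively_signable N'"
    then obtain d where d: "\<forall>a<k. d a \<in> {1, -1} \<and> (\<forall>b<k. d a * N' $$ (a, b) * d b \<ge> 0)"
      using positively_signable_iff[OF N'] by blast
    have "d (c p) * F' $$ (p, q) * d (c q) \<ge> 0" if "p < n" "q < n" for p q
    proof -
      have "d (c p) * F' $$ (p, q) * d (c q)
          = (w (c p) * w (c q)) * (d (c p) * N' $$ (c p, c q) * d (c q))"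
        using entry' that by simp
      also have "\<dots> \<ge> 0"
        using d ck[OF that(1)] ck[OF that(2)] w[of "c p"] w[of "c q"]
        by (intro mult_nonneg_nonneg[of "w (c p) * w (c q)"]) auto
      finally show ?thesis .
    qed
    then show "positively_signable F'"
      unfolding positively_signable_iff[OF F'] using d ck by (intro exI[of _ "d \<circ> c"]) auto
  qed
  show ?pos using pos[OF N F entry] .
  have "positively_signable (- F) \<longleftrightarrow> positively_signable (- N)"
    by (rule pos) (use N F entry ck in auto)
  then show ?neg using negatively_signable_iff_uminus N F by metis
qed

section \<open>The blown-up graph\<close>

text \<open>
  The increasing enumeration of \<open>{1..k}\<close> has \<open>Suc a\<close> at position \<open>a\<close>; this is the source of the index
  shift below.
\<close>
lemma adjacency_matrix_nat_interval:
  assumes "pverts G = {1..k}"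
  shows "adjacency_matrix G = mat k k (\<lambda>(a, b). if (Suc a, Suc b) \<in> parcs G then 1 else 0)"
proof -
  have "sorted_list_of_set {1..k} = [1..<Suc k]"
    using sorted_list_of_set_range[of 1 "Suc k"] by (simp add: atLeastLessThanSuc_atLeastAtMost)
  then show ?thesis
    using assms by (auto simp: adjacency_matrix_def Let_def simp del: upt_Suc intro!: eq_matI)
qed

text \<open>
  The classes need not be contiguous in the order of the vertices, so the position of a vertex
  determines its class only through a map \<open>c\<close>.  Class numbers are shifted to start at \<open>0\<close>.
\<close>
lemma class_index_exists:
  fixes V :: "nat \<Rightarrow> 'a::linorder set"
  assumes fin: "\<And>i. i \<in> {1..k} \<Longrightarrow> finite (V i)" and disj: "disjoint_family_on V {1..k}"
  defines "vs \<equiv> sorted_list_of_set (\<Union>i\<in>{1..k}. V i)"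
  obtains c where "\<And>p. p < length vs \<Longrightarrow> c p < k"
    and "\<And>p i. p < length vs \<Longrightarrow> i \<in> {1..k} \<Longrightarrow> vs ! p \<in> V i \<longleftrightarrow> i = Suc (c p)"
    and "\<And>a. a < k \<Longrightarrow> card {p \<in> {..<length vs}. c p = a} = card (V (Suc a))"
    and "length vs = (\<Sum>i = 1..k. card (V i))"
proof -
  have set_vs: "set vs = (\<Union>i\<in>{1..k}. V i)" and dist: "distinct vs"
    unfolding vs_def using fin by auto
  have "\<forall>p. \<exists>a. p < length vs \<longrightarrow> a < k \<and> vs ! p \<in> V (Suc a)"
  proof (intro allI)
    fix p
    show "\<exists>a. p < length vs \<longrightarrow> a < k \<and> vs ! p \<in> V (Suc a)"
    proof (cases "p < length vs")
      case True
      then obtain i where "i \<in> {1..k}" "vs ! p \<in> V i" using set_vs nth_mem by blast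
      then show ?thesis by (intro exI[of _ "i - 1"]) auto
    qed simp
  qed
  then obtain c where c: "\<And>p. p < length vs \<Longrightarrow> c p < k \<and> vs ! p \<in> V (Suc (c p))" by metis
  have iff: "vs ! p \<in> V i \<longleftrightarrow> i = Suc (c p)" if "p < length vs" "i \<in> {1..k}" for p i
  proof
    assume "vs ! p \<in> V i"
    then have "V i \<inter> V (Suc (c p)) \<noteq> {}" using c[OF that(1)] by blast
    then show "i = Suc (c p)"
      using disjoint_family_onD[OF disj, of i "Suc (c p)"] that(2) c[OF that(1)] by fastforce
  qed (use c that in simp)
  have card: "card {p \<in> {..<length vs}. c p = a} = card (V (Suc a))" if a: "a < k" for a
  proof (rule bij_betw_same_card[of "(!) vs"], rule bij_betw_imageI)
    show "inj_on ((!) vs) {p \<in> {..<length vs}. c p = a}"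
      using dist by (auto simp: inj_on_def nth_eq_iff_index_eq)
    show "(!) vs ` {p \<in> {..<length vs}. c p = a} = V (Suc a)"
    proof (intro equalityI subsetI)
      fix x assume x: "x \<in> V (Suc a)"
      with a have "x \<in> set vs" unfolding set_vs by auto
      then obtain p where "p < length vs" "vs ! p = x" by (auto simp: in_set_conv_nth)
      then show "x \<in> (!) vs ` {p \<in> {..<length vs}. c p = a}" using iff[of p "Suc a"] a x by auto
    qed (use c in auto)
  qed
  have "length vs = card (\<Union>i\<in>{1..k}. V i)"
    using distinct_card[OF dist] set_vs by simp
  also have "\<dots> = (\<Sum>i = 1..k. card (V i))"
    by (rule card_UN_disjoint) (use fin disj in \<open>auto simp: disjoint_family_on_def\<close>)
  finally show thesis using that[of c] c iff card by blast
qed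

theorem proposition2p8:
  fixes G :: "nat pair_pre_digraph"
    and k :: nat
    and m :: "nat \<Rightarrow> nat"
    and V :: "nat \<Rightarrow> 'a::linorder set"
    and H :: "'a pair_pre_digraph"
    and A M :: "real mat"
  assumes "pair_graph G"
    and "connected (with_proj G)"
    and "pverts G = {1..k}"
    and "\<And>i. i \<in> {1..k} \<Longrightarrow> m i \<ge> 1"
    and "\<And>i. i \<in> {1..k} \<Longrightarrow> finite (V i) \<and> card (V i) = m i"
    and "disjoint_family_on V {1..k}"
    and "H = complete_multipartitioned G V"
    and "A = adjacency_matrix G"
    and "M = mat_diag k (\<lambda>i. real (m (i + 1)))"
  shows
    "spectrum_mset (adjacency_matrix H) =
        replicate_mset ((\<Sum>i = 1..k. m i) - k) 0 + spectrum_mset (diag_mat_sqrt M * A * diag_mat_sqrt M)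
     \<and>
     (positively_signable (moore_penrose_inverse (diag_mat_sqrt M * A * diag_mat_sqrt M)) \<longleftrightarrow>
        positively_pseudo_invertible H)
     \<and>
     (negatively_signable (moore_penrose_inverse (diag_mat_sqrt M * A * diag_mat_sqrt M)) \<longleftrightarrow>
        negatively_pseudo_invertible H)
     \<and>
     (invertible_mat A \<longrightarrow>
        (positively_invertible G \<longleftrightarrow> positively_pseudo_invertible H) \<and>
        (negatively_invertible G \<longleftrightarrow> negatively_pseudo_invertible H))"
proof -
  interpret pair_graph G by fact
  note verts = \<open>pverts G = {1..k}\<close>
  define vs where "vs = sorted_list_of_set (\<Union>i\<in>{1..k}. V i)"
  define n where "n = length vs"
  define w where "w a = 1 / sqrt (real (m (Suc a)))" for a
  define S where "S = diag_mat_sqrt M"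
  define S' where "S' = mat_diag k w"
  define N where "N = S * A * S"
  have m_pos: "m (Suc a) \<ge> 1" if "a < k" for a using assms(4)[of "Suc a"] that by simp
  then have sqrt_pos: "sqrt (real (m (Suc a))) > 0" if "a < k" for a using that by (simp add: Suc_le_eq)
  then have w_pos: "w a > 0" if "a < k" for a using that by (simp add: w_def)
  obtain c where c: "\<And>p. p < n \<Longrightarrow> c p < k"
    and class_iff: "\<And>p i. p < n \<Longrightarrow> i \<in> {1..k} \<Longrightarrow> vs ! p \<in> V i \<longleftrightarrow> i = Suc (c p)"
    and card_class: "\<And>a. a < k \<Longrightarrow> card {p \<in> {..<n}. c p = a} = card (V (Suc a))"
    and n_card: "n = (\<Sum>i = 1..k. card (V i))"
    by (rule class_index_exists[of k V, folded vs_def n_def]) (use assms(5,6) in auto)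
  have card_fibre: "card {p \<in> {..<n}. c p = a} = m (Suc a)" if "a < k" for a
    using card_class[OF that] assms(5)[of "Suc a"] that by simp
  have n_sum: "n = (\<Sum>i = 1..k. m i)" using n_card assms(5) by simp
  have "(\<Sum>i = 1..k. 1) \<le> (\<Sum>i = 1..k. m i)" by (rule sum_mono) (use assms(4) in auto)
  then have "k \<le> n" using n_sum by simp
  have c_surj: "c ` {..<n} = {..<k}"
  proof (intro equalityI subsetI)
    fix a assume "a \<in> {..<k}"
    then have "card {p \<in> {..<n}. c p = a} \<noteq> 0" using card_fibre m_pos by force
    then have "{p \<in> {..<n}. c p = a} \<noteq> {}" by (metis card.empty)
    then show "a \<in> c ` {..<n}" by auto
  qed (use c in auto)

  have A_entry: "A = mat k k (\<lambda>(a, b). if (Suc a, Suc b) \<in> parcs G then 1 else 0)"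
    using adjacency_matrix_nat_interval[OF verts] assms(8) by simp
  then have A: "A \<in> carrier_mat k k" by simp
  have A_sym: "A\<^sup>T = A"
  proof (rule eq_matI)
    fix a b assume "a < dim_row A" "b < dim_col A"
    moreover have "(Suc b, Suc a) \<in> parcs G \<longleftrightarrow> (Suc a, Suc b) \<in> parcs G"
      using arcs_symmetric by blast
    ultimately show "A\<^sup>T $$ (a, b) = A $$ (a, b)" using A_entry by simp
  qed (use A in auto)
  have S_diag: "S = mat_diag k (\<lambda>a. sqrt (real (m (Suc a))))"
    unfolding S_def diag_mat_sqrt_def assms(9) by (auto simp: mat_diag_def intro!: eq_matI)
  then have S: "S \<in> carrier_mat k k" by simp
  have N: "N \<in> carrier_mat k k" using S A by (simp add: N_def)
  have N_entry: "N $$ (a, b) = sqrt (real (m (Suc a))) * A $$ (a, b) * sqrt (real (m (Suc b)))"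
    if "a < k" "b < k" for a b
    using that A unfolding N_def S_diag
    by (simp add: mat_diag_mult_left[of _ k k] mat_diag_mult_right[of _ k k])
  have N_sym: "N\<^sup>T = N"
  proof (rule eq_matI)
    fix a b assume ab: "a < dim_row N" "b < dim_col N"
    then have "A $$ (b, a) = A $$ (a, b)" using A A_sym N by (metis carrier_matD index_transpose_mat(1))
    then show "N\<^sup>T $$ (a, b) = N $$ (a, b)" using ab N N_entry by simp
  qed (use N in auto)

  \<comment> \<open>The weights \<open>w\<close> turn the class indicators into unit vectors and cancel the square roots in \<open>N\<close>.\<close>
  define U where "U = fibre_mat n k c w"
  have U: "U \<in> carrier_mat n k" by (simp add: U_def)
  have UU: "U\<^sup>T * U = 1\<^sub>m k"
    unfolding U_def
  proof (rule fibre_mat_isometry)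
    fix a assume "a < k"
    then show "(w a)\<^sup>2 * real (card {p \<in> {..<n}. c p = a}) = 1"
      using m_pos[of a] card_fibre[of a] by (simp add: w_def power_divide)
  qed
  have H_factor: "adjacency_matrix H = U * N * U\<^sup>T"
  proof (rule eq_matI)
    have dim: "adjacency_matrix H
        = mat n n (\<lambda>(p, q). if (vs ! p, vs ! q) \<in> parcs H then 1 else 0)"
      unfolding adjacency_matrix_def Let_def assms(7) complete_multipartitioned_def
      by (simp add: verts vs_def n_def)
    then show "dim_row (adjacency_matrix H) = dim_row (U * N * U\<^sup>T)"
      "dim_col (adjacency_matrix H) = dim_col (U * N * U\<^sup>T)" using U by auto
    fix p q assume "p < dim_row (U * N * U\<^sup>T)" "q < dim_col (U * N * U\<^sup>T)"
    then have pq: "p < n" "q < n" using U by auto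
    have "(vs ! p, vs ! q) \<in> parcs H \<longleftrightarrow> (\<exists>(i, j)\<in>parcs G. vs ! p \<in> V i \<and> vs ! q \<in> V j)"
      unfolding assms(7) complete_multipartitioned_def by simp
    also have "\<dots> \<longleftrightarrow> (\<exists>(i, j)\<in>parcs G. i = Suc (c p) \<and> j = Suc (c q))"
    proof -
      have "vs ! p \<in> V i \<and> vs ! q \<in> V j \<longleftrightarrow> i = Suc (c p) \<and> j = Suc (c q)"
        if "(i, j) \<in> parcs G" for i j
      proof -
        have "i \<in> {1..k}" "j \<in> {1..k}"
          using in_arcsD1[OF that] in_arcsD2[OF that] verts by simp_all
        then show ?thesis using class_iff pq by simp
      qed
      then show ?thesis by auto
    qed
    finally have "(vs ! p, vs ! q) \<in> parcs H \<longleftrightarrow> (Suc (c p), Suc (c q)) \<in> parcs G" by auto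
    then have "adjacency_matrix H $$ (p, q) = A $$ (c p, c q)"
      using dim A_entry pq c by simp
    also have "\<dots> = w (c p) * N $$ (c p, c q) * w (c q)"
      using N_entry c[OF pq(1)] c[OF pq(2)] sqrt_pos[of "c p"] sqrt_pos[of "c q"]
      by (simp add: w_def)
    also have "\<dots> = (U * N * U\<^sup>T) $$ (p, q)"
      unfolding U_def using fibre_mat_conjugate_index[OF N c pq] by simp
    finally show "adjacency_matrix H $$ (p, q) = (U * N * U\<^sup>T) $$ (p, q)" .
  qed

  have spectrum: "spectrum_mset (adjacency_matrix H)
      = replicate_mset ((\<Sum>i = 1..k. m i) - k) 0 + spectrum_mset N"
    unfolding H_factor n_sum[symmetric]
    by (rule spectrum_mset_isometric_conjugate[OF U N UU \<open>k \<le> n\<close>])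

  obtain X where X: "is_moore_penrose_inverse N X"
    using symmetric_moore_penrose_exists[OF N N_sym] by blast
  then have Xc: "X \<in> carrier_mat k k" using N by (simp add: is_moore_penrose_inverse_def)
  have pinv_N: "moore_penrose_inverse N = X"
    using X by (rule moore_penrose_inverse_eqI)
  have pinv_H: "moore_penrose_inverse (adjacency_matrix H) = U * X * U\<^sup>T"
    unfolding H_factor
    by (rule moore_penrose_inverse_eqI, rule moore_penrose_isometric_conjugate[OF U N UU X])
  have entry: "(U * X * U\<^sup>T) $$ (p, q) = w (c p) * X $$ (c p, c q) * w (c q)"
    if "p < n" "q < n" for p q
    unfolding U_def using fibre_mat_conjugate_index[OF Xc c that] .
  have "U * X * U\<^sup>T \<in> carrier_mat n n" using U Xc by simp
  note lift = signable_weighted_pullback[OF Xc this c_surj w_pos entry]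
  have pos: "positively_signable (moore_penrose_inverse N) \<longleftrightarrow> positively_pseudo_invertible H"
    and neg: "negatively_signable (moore_penrose_inverse N) \<longleftrightarrow> negatively_pseudo_invertible H"
    unfolding positively_pseudo_invertible_def negatively_pseudo_invertible_def pinv_N pinv_H
    using lift by simp_all

  have inv: "(positively_invertible G \<longleftrightarrow> positively_pseudo_invertible H) \<and>
      (negatively_invertible G \<longleftrightarrow> negatively_pseudo_invertible H)" if A_inv: "invertible_mat A"
  proof -
    obtain A' where AA': "A * A' = 1\<^sub>m k" and A'A: "A' * A = 1\<^sub>m (dim_row A')"
      using A_inv A by (auto simp: invertible_mat_def inverts_mat_def)
    have A': "A' \<in> carrier_mat k k"
      using arg_cong[OF AA', of dim_col] arg_cong[OF A'A, of dim_col] A by auto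
    have S': "S' \<in> carrier_mat k k" by (simp add: S'_def)
    have "mat_diag k (\<lambda>a. sqrt (real (m (Suc a))) * w a) = 1\<^sub>m k"
      by (rule eq_matI) (auto simp: mat_diag_def w_def dest: m_pos)
    then have SS': "S * S' = 1\<^sub>m k" "S' * S = 1\<^sub>m k"
      unfolding S_diag S'_def by (simp_all add: mult.commute)
    have cancel: "P * (Q * C) = C" if "P * Q = 1\<^sub>m k" "P \<in> carrier_mat k k" "Q \<in> carrier_mat k k"
      "C \<in> carrier_mat k k" for P Q C :: "real mat"
      using that by (simp del: assoc_mult_mat flip: mult_mat_assoc_dim)
    \<comment> \<open>\<open>S\<close> and \<open>S'\<close> are mutually inverse, so \<open>S' A' S'\<close> is the inverse of \<open>S A S\<close>.\<close>
    have "N * (S' * A' * S') = 1\<^sub>m k" "S' * A' * S' * N = 1\<^sub>m k"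
      unfolding N_def using S S' A A' AA' A'A SS'
      by (simp_all add: mult_mat_assoc_dim cancel[of S S'] cancel[of S' S] cancel[of A A'] cancel[of A' A])
    then have "moore_penrose_inverse N = S' * A' * S'"
      using moore_penrose_inverse_of_inverse[OF N] S' A' by simp
    then have X_eq: "X = S' * A' * S'" using pinv_N by simp
    have "X $$ (a, b) = w (id a) * A' $$ (id a, id b) * w (id b)" if "a < k" "b < k" for a b
      using that A' unfolding X_eq S'_def
      by (simp add: mat_diag_mult_left[of _ k k] mat_diag_mult_right[of _ k k])
    \<comment> \<open>Every class is a singleton here, with the identity as class map.\<close>
    note scale = signable_weighted_pullback[OF A' Xc _ w_pos this]
    have "moore_penrose_inverse A = A'"
      using moore_penrose_inverse_of_inverse[OF A A' AA'] A'A A' by simp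
    then show ?thesis
      using A_inv scale pos neg pinv_N assms(8)
      unfolding positively_invertible_def negatively_invertible_def
        positively_pseudo_invertible_def negatively_pseudo_invertible_def by simp
  qed
  show ?thesis
    using spectrum pos neg inv unfolding N_def S_def by blast
qed

end
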